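(* The function $f_6$ assigning to each integer $n\ge 1$ the Euler characteristic $f_6(n)=\chi(I(\Gamma_{n,6}))$ is periodic with period $28$ (i.e. $f_6(n+28)=f_6(n)$ for all $n\ge 1$), and its values for $n=1,2,\dots,28$ are, in order, $$0,\,2,\,2,\,-2,\,0,\,4,\,0,\,-4,\,2,\,6,\,-2,\,-4,\,4,\,4,\,-4,\,-2,\,6,\,2,\,-4,\,0,\,4,\,0,\,-2,\,2,\,2,\,0,\,0,\,0.$$
   Context: For a finite simple graph $G=(V,E)$, the independence complex $I(G)$ is the simplicial complex with vertex set $V$ whose simplices are the independent sets of $G$ (subsets of $V$ containing no two adjacent vertices). The grid graph $\Gamma_{n,6}$ has vertex set $\{(x,y)\in\mathbb{Z}^2\mid 1\le x\le n,\ 1\le y\le 6\}$, with $(x,y)$ and $(x',y')$ adjacent if and only if $|x'-x|+|y'-y|=1$. Here $\chi$ is the ordinary (unreduced) Euler characteristic, so $\chi(S^d)=1+(-1)^d$. *)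

theory Defs
  imports Complex_Main
begin

text \<open>A finite simple graph is given by its vertex set \<open>V\<close> and its set \<open>E\<close> of edges, each edge
  being a two-element subset of \<open>V\<close>.\<close>

definition independent_in :: "'a set set \<Rightarrow> 'a set \<Rightarrow> bool" where
  "independent_in E S \<longleftrightarrow> (\<forall>u\<in>S. \<forall>v\<in>S. {u, v} \<notin> E)"

text \<open>The complex contains the empty independent set, as the empty simplex.\<close>

definition independence_complex :: "'a set \<Rightarrow> 'a set set \<Rightarrow> 'a set set" where
  "independence_complex V E = {S. S \<subseteq> V \<and> independent_in E S}"

text \<open>Unreduced Euler characteristic of a finite abstract simplicial complex: a simplex \<open>\<sigma>\<close> has
  dimension \<open>card \<sigma> - 1\<close>, and the empty simplex is not counted.\<close>

definition euler_characteristic :: "'a set set \<Rightarrow> int" where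
  "euler_characteristic K = (\<Sum>\<sigma>\<in>K - {{}}. (-1) ^ (card \<sigma> - 1))"

definition grid_vertices :: "nat \<Rightarrow> nat \<Rightarrow> (int \<times> int) set" where
  "grid_vertices n m = {(x, y). 1 \<le> x \<and> x \<le> int n \<and> 1 \<le> y \<and> y \<le> int m}"

definition grid_edges :: "nat \<Rightarrow> nat \<Rightarrow> (int \<times> int) set set" where
  "grid_edges n m = {{(x, y), (x', y')} | x y x' y'.
     (x, y) \<in> grid_vertices n m \<and> (x', y') \<in> grid_vertices n m \<and> \<bar>x' - x\<bar> + \<bar>y' - y\<bar> = 1}"

definition f6 :: "nat \<Rightarrow> int" where
  "f6 n = euler_characteristic (independence_complex (grid_vertices n 6) (grid_edges n 6))"

end

theory Submission
  imports Defs
begin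

text \<open>The sum of \<open>(-1) ^ card S\<close> over all independent sets \<open>S\<close> of the grid, the empty set
  included, is one minus the Euler characteristic of the independence complex. It is computed by a
  transfer matrix, column by column. An independent set of the grid with \<open>n + 1\<close> columns is an
  independent set \<open>S\<close> of the grid with \<open>n\<close> columns together with an independent set \<open>B\<close> of
  a path, its last column; the two only have to satisfy that no point of \<open>S\<close> in column \<open>n\<close> has
  its height in \<open>B\<close>. For a set \<open>A\<close> of heights let \<open>u n A\<close> be the signed sum over those
  independent sets whose column \<open>n\<close> avoids \<open>A\<close>. Then \<open>u (n + 1) A\<close> is the sum of
  \<open>(-1) ^ card B * u n B\<close> over the independent sets \<open>B\<close> of the path that are disjoint from
  \<open>A\<close> (lemma \<open>signed_count_Suc\<close>), and \<open>u 0\<close> is constantly one.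

  A path with six vertices has 21 independent sets, so for width six the vector \<open>u n\<close> has 21
  entries and arises from the all-ones vector by applying the same matrix \<open>n\<close> times. The matrix
  brings the all-ones vector back to itself after 28 steps (lemma \<open>orbit_closes\<close>), hence \<open>u\<close>
  is periodic. The values of \<open>f6\<close> are read off from the entries at the empty set along this orbit
  (lemma \<open>orbit_heads\<close>). That the orbit closes does not follow from
  the recursion alone, which holds for every width; it is seen by carrying out the 28 steps.\<close>

section \<open>Signed counts of independent sets in grids\<close>

lemma grid_edge_iff:
  "{(x, y), (x', y')} \<in> grid_edges n m \<longleftrightarrow>
     (x, y) \<in> grid_vertices n m \<and> (x', y') \<in> grid_vertices n m \<and> \<bar>x' - x\<bar> + \<bar>y' - y\<bar> = 1"
  unfolding grid_edges_def by (auto simp: doubleton_eq_iff abs_minus_commute)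

text \<open>Each edge of a grid leads up or right from one of its end points, so it suffices to look in
  these two directions; this form does not mention the size of the grid and is inherited by parts
  of a grid.\<close>

definition grid_independent :: "(int \<times> int) set \<Rightarrow> bool" where
  "grid_independent S \<longleftrightarrow> (\<forall>(x, y)\<in>S. (x + 1, y) \<notin> S \<and> (x, y + 1) \<notin> S)"

lemma independent_in_grid_iff:
  assumes "S \<subseteq> grid_vertices n m"
  shows "independent_in (grid_edges n m) S \<longleftrightarrow> grid_independent S"
proof
  assume "independent_in (grid_edges n m) S"
  then have sep: "\<bar>x' - x\<bar> + \<bar>y' - y\<bar> \<noteq> 1" if "(x, y) \<in> S" "(x', y') \<in> S" for x y x' y'
    using that assms grid_edge_iff[of x y x' y' n m] unfolding independent_in_def by blast
  show "grid_independent S"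
    unfolding grid_independent_def using sep by fastforce
next
  assume S: "grid_independent S"
  have "\<bar>x' - x\<bar> + \<bar>y' - y\<bar> \<noteq> 1" if *: "(x, y) \<in> S" "(x', y') \<in> S" for x y x' y'
  proof
    assume "\<bar>x' - x\<bar> + \<bar>y' - y\<bar> = 1"
    then have "x' = x + 1 \<and> y' = y \<or> x = x' + 1 \<and> y' = y \<or> x' = x \<and> y' = y + 1 \<or> x' = x \<and> y = y' + 1"
      by linarith
    then show False
      using * S unfolding grid_independent_def by blast
  qed
  then show "independent_in (grid_edges n m) S"
    unfolding independent_in_def by (auto simp: grid_edge_iff)
qed

text \<open>Remembering which heights the last column avoids is exactly what is needed to decide by which
  columns an independent set can be continued. For \<open>n = 0\<close> the column \<open>0\<close> is empty and the
  restriction is void.\<close>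

definition grid_sets :: "nat \<Rightarrow> nat \<Rightarrow> int set \<Rightarrow> (int \<times> int) set set" where
  "grid_sets m n A =
     {S. S \<subseteq> grid_vertices n m \<and> grid_independent S \<and> (\<forall>y\<in>A. (int n, y) \<notin> S)}"

definition signed_count :: "nat \<Rightarrow> nat \<Rightarrow> int set \<Rightarrow> int" where
  "signed_count m n A = (\<Sum>S\<in>grid_sets m n A. (-1) ^ card S)"

lemma finite_grid_vertices: "finite (grid_vertices n m)"
proof (rule finite_subset)
  show "grid_vertices n m \<subseteq> {1..int n} \<times> {1..int m}"
    by (auto simp: grid_vertices_def)
qed simp

lemma finite_grid_sets: "finite (grid_sets m n A)"
  by (rule finite_subset[of _ "Pow (grid_vertices n m)"])
    (auto simp: grid_sets_def finite_grid_vertices)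

lemma euler_characteristic_eq_one_minus:
  assumes "finite K" "{} \<in> K" "\<And>\<sigma>. \<sigma> \<in> K \<Longrightarrow> finite \<sigma>"
  shows "euler_characteristic K = 1 - (\<Sum>\<sigma>\<in>K. (-1) ^ card \<sigma>)"
proof -
  have "(-1) ^ (card \<sigma> - 1) = - ((-1) ^ card \<sigma> :: int)" if "\<sigma> \<in> K - {{}}" for \<sigma>
  proof -
    have "card \<sigma> \<noteq> 0"
      using assms(3) that by simp
    then show ?thesis
      by (cases "card \<sigma>") auto
  qed
  then have "euler_characteristic K = - (\<Sum>\<sigma>\<in>K - {{}}. (-1) ^ card \<sigma>)"
    unfolding euler_characteristic_def by (simp add: sum_negf)
  also have "\<dots> = 1 - (\<Sum>\<sigma>\<in>K. (-1) ^ card \<sigma>)"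
    using assms(1,2) by (simp add: sum.remove)
  finally show ?thesis .
qed

lemma f6_eq: "f6 n = 1 - signed_count 6 n {}"
proof -
  have K: "independence_complex (grid_vertices n 6) (grid_edges n 6) = grid_sets 6 n {}"
    unfolding independence_complex_def grid_sets_def by (auto simp: independent_in_grid_iff)
  have "{} \<in> grid_sets 6 n {}"
    by (auto simp: grid_sets_def grid_independent_def)
  moreover have "finite \<sigma>" if "\<sigma> \<in> grid_sets 6 n {}" for \<sigma>
    using that finite_grid_vertices[of n 6] by (auto simp: grid_sets_def intro: finite_subset)
  ultimately show ?thesis
    unfolding f6_def K signed_count_def
    by (simp add: euler_characteristic_eq_one_minus finite_grid_sets)
qed

definition path_sets :: "nat \<Rightarrow> int set set" where
  "path_sets m = {B. B \<subseteq> {1..int m} \<and> (\<forall>y\<in>B. y + 1 \<notin> B)}"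

lemma finite_path_sets: "finite (path_sets m)"
  by (rule finite_subset[of _ "Pow {1..int m}"]) (auto simp: path_sets_def)

lemma signed_count_0: "signed_count m 0 A = 1"
proof -
  have "grid_sets m 0 A = {{}}"
    by (auto simp: grid_sets_def grid_vertices_def grid_independent_def)
  then show ?thesis
    by (simp add: signed_count_def)
qed

text \<open>An independent set of the larger grid is cut into its last column \<open>B\<close> and the remaining
  part \<open>S\<close>. This is a bijection onto the pairs in which \<open>B\<close> is independent in the path and
  avoids \<open>A\<close>, and the column \<open>n\<close> of \<open>S\<close> avoids \<open>B\<close>; signs multiply because
  cardinalities add.\<close>

lemma signed_count_Suc:
  "signed_count m (Suc n) A =
     (\<Sum>B\<in>{B \<in> path_sets m. A \<inter> B = {}}. (-1) ^ card B * signed_count m n B)"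
proof -
  let ?C = "{B \<in> path_sets m. A \<inter> B = {}}"
  let ?N = "int n + 1"
  have C: "finite ?C"
    by (simp add: finite_path_sets)
  have "(\<Sum>B\<in>?C. (-1) ^ card B * signed_count m n B) =
      (\<Sum>(B, S)\<in>Sigma ?C (grid_sets m n). (-1) ^ card B * (-1) ^ card S)"
    unfolding signed_count_def sum_distrib_left
    using C finite_grid_sets by (subst sum.Sigma) auto
  also have "\<dots> = (\<Sum>S\<in>grid_sets m (Suc n) A. (-1) ^ card S)"
  proof (rule sum.reindex_bij_witness[where
        j = "\<lambda>(B, S). S \<union> {?N} \<times> B" and i = "\<lambda>S. ({y. (?N, y) \<in> S}, {p \<in> S. fst p \<noteq> ?N})"])
    fix p assume p: "p \<in> Sigma ?C (grid_sets m n)"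
    obtain B S where [simp]: "p = (B, S)" by (cases p)
    have BS: "B \<in> path_sets m" "A \<inter> B = {}" "S \<in> grid_sets m n B"
      using p by auto
    then have left: "x \<le> int n" if "(x, y) \<in> S" for x y
      using that by (auto simp: grid_sets_def grid_vertices_def)
    have [simp]: "(?N, y) \<notin> S" for y
      using left[of ?N y] by auto
    show "({y. (?N, y) \<in> (case p of (B, S) \<Rightarrow> S \<union> {?N} \<times> B)},
        {q \<in> (case p of (B, S) \<Rightarrow> S \<union> {?N} \<times> B). fst q \<noteq> ?N}) = p"
      by auto
    have "grid_independent (S \<union> {?N} \<times> B)"
    proof -
      have [simp]: "(x, y) \<notin> S" if "x > int n" for x y
        using left[of x y] that by auto
      show ?thesis
        using BS unfolding grid_independent_def grid_sets_def path_sets_def by fastforce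
    qed
    then show "(case p of (B, S) \<Rightarrow> S \<union> {?N} \<times> B) \<in> grid_sets m (Suc n) A"
      using BS by (fastforce simp: grid_sets_def path_sets_def grid_vertices_def)
    have "finite B"
      using BS(1) finite_subset by (auto simp: path_sets_def)
    moreover have "finite S"
      using BS(3) finite_grid_vertices finite_subset by (auto simp: grid_sets_def)
    moreover have "S \<inter> {?N} \<times> B = {}"
      by auto
    ultimately have "card (S \<union> {?N} \<times> B) = card S + card B"
      by (simp add: card_Un_disjoint card_cartesian_product)
    then show "(-1) ^ card (case p of (B, S) \<Rightarrow> S \<union> {?N} \<times> B) =
        (case p of (B, S) \<Rightarrow> (-1) ^ card B * (-1 :: int) ^ card S)"
      by (simp add: power_add)
  next
    fix S assume S: "S \<in> grid_sets m (Suc n) A"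
    show "(case ({y. (?N, y) \<in> S}, {p \<in> S. fst p \<noteq> ?N}) of (B, S) \<Rightarrow> S \<union> {?N} \<times> B) = S"
      by auto
    have "{y. (?N, y) \<in> S} \<in> ?C"
    proof -
      have "S \<subseteq> grid_vertices (Suc n) m" "grid_independent S" "\<forall>y\<in>A. (?N, y) \<notin> S"
        using S by (auto simp: grid_sets_def add.commute)
      then show ?thesis
        unfolding path_sets_def grid_vertices_def grid_independent_def by auto
    qed
    moreover have "{p \<in> S. fst p \<noteq> ?N} \<in> grid_sets m n {y. (?N, y) \<in> S}"
    proof -
      have V: "S \<subseteq> grid_vertices (Suc n) m" and I: "grid_independent S"
        using S by (auto simp: grid_sets_def)
      have "{p \<in> S. fst p \<noteq> ?N} \<subseteq> grid_vertices n m"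
      proof
        fix p assume "p \<in> {p \<in> S. fst p \<noteq> ?N}"
        then have "p \<in> grid_vertices (Suc n) m" "fst p \<noteq> ?N"
          using V by auto
        then show "p \<in> grid_vertices n m"
          unfolding grid_vertices_def by auto
      qed
      moreover have "grid_independent {p \<in> S. fst p \<noteq> ?N}"
        using I unfolding grid_independent_def by auto
      moreover have "\<forall>y\<in>{y. (?N, y) \<in> S}. (int n, y) \<notin> S"
        using I unfolding grid_independent_def by auto
      ultimately show ?thesis
        unfolding grid_sets_def by auto
    qed
    ultimately show "({y. (?N, y) \<in> S}, {p \<in> S. fst p \<noteq> ?N}) \<in> Sigma ?C (grid_sets m n)"
      by auto
  qed
  finally show ?thesis
    by (simp add: signed_count_def)
qed

section \<open>The recursion as a matrix\<close>

text \<open>An independent set of a path either omits the last vertex or contains it and omits the one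
  before, which gives the Fibonacci recursion below. Each set occurs once, as a decreasing list.\<close>

fun path_lists :: "nat \<Rightarrow> int list list" where
  "path_lists 0 = [[]]"
| "path_lists (Suc 0) = [[], [1]]"
| "path_lists (Suc (Suc m)) = path_lists (Suc m) @ map ((#) (int m + 2)) (path_lists m)"

lemma path_sets_Suc_Suc:
  "path_sets (Suc (Suc m)) = path_sets (Suc m) \<union> insert (int m + 2) ` path_sets m"
proof (intro subset_antisym subsetI)
  fix B assume B: "B \<in> path_sets (Suc (Suc m))"
  show "B \<in> path_sets (Suc m) \<union> insert (int m + 2) ` path_sets m"
  proof (cases "int m + 2 \<in> B")
    case True
    have "int m + 1 \<notin> B"
    proof
      assume "int m + 1 \<in> B"
      then have "(int m + 1) + 1 \<notin> B"
        using B unfolding path_sets_def by blast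
      then show False
        using True by (simp add: add.assoc)
    qed
    have "y \<in> {1..int m}" if "y \<in> B" "y \<noteq> int m + 2" for y
    proof -
      have "1 \<le> y" "y \<le> int m + 2" "y \<noteq> int m + 1"
        using that B \<open>int m + 1 \<notin> B\<close> by (auto simp: path_sets_def)
      then show ?thesis using that by simp
    qed
    then have "B - {int m + 2} \<subseteq> {1..int m}"
      by blast
    then have "B - {int m + 2} \<in> path_sets m"
      using B unfolding path_sets_def by blast
    then show ?thesis
      using True by (metis UnI2 image_eqI insert_Diff)
  next
    case False
    have "y \<in> {1..int (Suc m)}" if "y \<in> B" for y
    proof -
      have "1 \<le> y" "y \<le> int m + 2" "y \<noteq> int m + 2"
        using that B False by (auto simp: path_sets_def)
      then show ?thesis by simp
    qed
    then have "B \<subseteq> {1..int (Suc m)}"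
      by blast
    then show ?thesis
      using B unfolding path_sets_def by blast
  qed
next
  fix B assume "B \<in> path_sets (Suc m) \<union> insert (int m + 2) ` path_sets m"
  then show "B \<in> path_sets (Suc (Suc m))"
    by (fastforce simp: path_sets_def)
qed

lemma sum_path_sets:
  "(\<Sum>B\<in>path_sets m. g B) = (\<Sum>B\<leftarrow>path_lists m. g (set B))" for g :: "int set \<Rightarrow> int"
proof (induction m arbitrary: g rule: path_lists.induct)
  case 1
  have "path_sets 0 = {{}}"
    by (auto simp: path_sets_def)
  then show ?case by simp
next
  case 2
  have "path_sets (Suc 0) = {{}, {1}}"
    by (auto simp: path_sets_def)
  then show ?case by simp
next
  case (3 m)
  have top: "int m + 2 \<notin> B" if "B \<in> path_sets (Suc m) \<or> B \<in> path_sets m" for B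
    using that by (auto simp: path_sets_def)
  then have "path_sets (Suc m) \<inter> insert (int m + 2) ` path_sets m = {}"
    by auto
  moreover have "inj_on (insert (int m + 2)) (path_sets m)"
    using top by (intro inj_onI) (metis insert_ident)
  ultimately show ?case
    by (simp add: path_sets_Suc_Suc sum.union_disjoint finite_path_sets sum.reindex 3 comp_def)
qed

text \<open>The second conjunct carries the induction: it shows that the new head is not yet in the list.\<close>

lemma card_set_path_list: "B \<in> set (path_lists m) \<Longrightarrow> card (set B) = length B \<and> set B \<subseteq> {..int m}"
  by (induction m arbitrary: B rule: path_lists.induct) (fastforce simp: card_insert_if)+

definition transfer_matrix :: "nat \<Rightarrow> int list list" where
  "transfer_matrix m = map (\<lambda>A. map (\<lambda>B.
     if list_all (\<lambda>y. \<not> List.member A y) B then (-1) ^ length B else 0) (path_lists m)) (path_lists m)"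

text \<open>Matrix multiplication and iteration are written as first-order recursions, because rewriting
  then evaluates each vector once; a vector captured in a \<open>\<lambda>\<close>-abstraction would be
  evaluated symbolically as well, at a prohibitive cost.\<close>

fun scalar_product :: "int list \<Rightarrow> int list \<Rightarrow> int" where
  "scalar_product (a # as) (z # zs) = a * z + scalar_product as zs"
| "scalar_product _ _ = 0"

fun mat_vec :: "int list list \<Rightarrow> int list \<Rightarrow> int list" where
  "mat_vec [] v = []"
| "mat_vec (r # rs) v = scalar_product r v # mat_vec rs v"

fun orbit :: "nat \<Rightarrow> int list list \<Rightarrow> int list \<Rightarrow> int list list" where
  "orbit 0 M v = [v]"
| "orbit (Suc k) M v = v # orbit k M (mat_vec M v)"

lemma scalar_product_map: "scalar_product (map f xs) (map g xs) = (\<Sum>x\<leftarrow>xs. f x * g x)"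
  by (induction xs) auto

lemma mat_vec_eq_map: "mat_vec M v = map (\<lambda>r. scalar_product r v) M"
  by (induction M) auto

lemma orbit_eq_map: "orbit k M v = map (\<lambda>n. (mat_vec M ^^ n) v) [0..<Suc k]"
proof (induction k arbitrary: v)
  case (Suc k)
  have "[0..<Suc (Suc k)] = 0 # map Suc [0..<Suc k]"
    by (subst upt_conv_Cons) (simp_all only: map_Suc_upt zero_less_Suc)
  then show ?case
    by (simp add: Suc comp_def funpow_swap1 del: upt_Suc)
qed simp

definition count_vector :: "nat \<Rightarrow> nat \<Rightarrow> int list" where
  "count_vector m n = map (\<lambda>A. signed_count m n (set A)) (path_lists m)"

lemma count_vector_0: "count_vector m 0 = map (\<lambda>_. 1) (path_lists m)"
  by (simp add: count_vector_def signed_count_0)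

lemma count_vector_Suc: "count_vector m (Suc n) = mat_vec (transfer_matrix m) (count_vector m n)"
proof -
  have "signed_count m (Suc n) (set A) = scalar_product (map (\<lambda>B.
      if list_all (\<lambda>y. \<not> List.member A y) B then (-1) ^ length B else 0) (path_lists m))
      (count_vector m n)" for A
  proof -
    have "signed_count m (Suc n) (set A) =
        (\<Sum>B\<in>path_sets m. if set A \<inter> B = {} then (-1) ^ card B * signed_count m n B else 0)"
      by (simp add: signed_count_Suc finite_path_sets sum.inter_filter)
    also have "\<dots> = (\<Sum>B\<leftarrow>path_lists m.
        (if list_all (\<lambda>y. \<not> List.member A y) B then (-1) ^ length B else 0) *
        signed_count m n (set B))"
      unfolding sum_path_sets
      by (intro arg_cong[of _ _ sum_list] map_cong refl)
        (auto simp: card_set_path_list list_all_iff)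
    finally show ?thesis
      by (simp add: count_vector_def scalar_product_map)
  qed
  then show ?thesis
    by (simp add: transfer_matrix_def count_vector_def mat_vec_eq_map comp_def)
qed

lemma count_vector_eq_power:
  "count_vector m n = (mat_vec (transfer_matrix m) ^^ n) (map (\<lambda>_. 1) (path_lists m))"
  by (induction n) (simp_all add: count_vector_0 count_vector_Suc)

lemma f6_eq_hd: "f6 n = 1 - hd ((mat_vec (transfer_matrix 6) ^^ n) (map (\<lambda>_. 1) (path_lists 6)))"
proof -
  \<comment> \<open>The empty column comes first in the enumeration, and avoiding it is no restriction.\<close>
  have "hd (count_vector 6 n) = signed_count 6 n {}"
    by (simp add: count_vector_def eval_nat_numeral)
  then show ?thesis
    by (simp add: f6_eq count_vector_eq_power)
qed

section \<open>The orbit for width six\<close>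

lemma orbit_closes:
  "last (orbit 28 (transfer_matrix 6) (map (\<lambda>_. 1) (path_lists 6))) = map (\<lambda>_. 1) (path_lists 6)"
  by code_simp

lemma orbit_heads:
  "map (\<lambda>v. 1 - hd v) (tl (orbit 28 (transfer_matrix 6) (map (\<lambda>_. 1) (path_lists 6)))) =
    [0, 2, 2, -2, 0, 4, 0, -4, 2, 6, -2, -4, 4, 4, -4, -2, 6, 2, -4, 0, 4, 0, -2, 2, 2, 0, 0, 0]"
  by code_simp

theorem corollary1p2:
  shows "(\<forall>n\<ge>1. f6 (n + 28) = f6 n) \<and>
    map f6 [1..<29] =
      [0, 2, 2, -2, 0, 4, 0, -4, 2, 6, -2, -4, 4, 4, -4, -2, 6, 2, -4, 0, 4, 0, -2, 2, 2, 0, 0, 0]"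
proof
  have "(mat_vec (transfer_matrix 6) ^^ 28) (map (\<lambda>_. 1) (path_lists 6)) = map (\<lambda>_. 1) (path_lists 6)"
    using orbit_closes unfolding orbit_eq_map upt_Suc by simp
  then show "\<forall>n\<ge>1. f6 (n + 28) = f6 n"
    by (simp add: f6_eq_hd funpow_add)
  have "map (\<lambda>v. 1 - hd v) (tl (orbit 28 (transfer_matrix 6) (map (\<lambda>_. 1) (path_lists 6)))) =
      map f6 [1..<29]"
    by (simp add: orbit_eq_map f6_eq_hd map_tl[symmetric] comp_def del: upt_Suc)
  then show "map f6 [1..<29] =
      [0, 2, 2, -2, 0, 4, 0, -4, 2, 6, -2, -4, 4, 4, -4, -2, 6, 2, -4, 0, 4, 0, -2, 2, 2, 0, 0, 0]"
    by (simp only: orbit_heads)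
qed

end
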